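(* Let $i\in[m]$ and let $\mathbf b^i\in\mathbb R^m$ be the vector with $i$-th component equal to $b_i$ and zeros everywhere else. If $(\alpha^*,\beta^*,\gamma^*,\theta^*,M^* )$ is an $\epsilon$-optimal solution of (COP), then $(\alpha^*-\mathbf b^i,\ \beta^*+\mathbf e_i,\ \gamma^*,\ \theta^*+b_i^2,\ M^*+K\!K_i)$ is also an $\epsilon$-optimal solution of (COP).
   Context: $[m]=\{1,\dots,m\}$. Data: $Q$ a symmetric rational $n\times n$ matrix, $\mathbf b\in\mathbb Q^m$, $\mathbf c,\mathbf a_i\in\mathbb Q^n$ ($i\in[m]$), $\mathcal B\subseteq[n]$. $\mathbf e_i$ denotes a standard basis vector. $\mathcal{COP}$ is the cone of copositive matrices (symmetric $M$ with $\mathbf y^\top M\mathbf y\ge0$ for all $\mathbf y\ge0$). Define the $(n+1)\times(n+1)$ matrices $$A_i=\begin{bmatrix}0&\mathbf a_i^\top\\ \mathbf a_i&0\end{bmatrix},\ AA_i=\begin{bmatrix}0&0\\0&\mathbf a_i\mathbf a_i^\top\end{bmatrix},\ T=\begin{bmatrix}1&0\\0&0\end{bmatrix},\ N_j=\begin{bmatrix}0&-\mathbf e_j^\top\\-\mathbf e_j&2\mathbf e_j\mathbf e_j^\top\end{bmatrix},\ C=\begin{bmatrix}0&\mathbf c^\top\\\mathbf c&Q\end{bmatrix},$$ and $K\!K_i=-b_iA_i+AA_i+b_i^2T$. (COP): $z_{\mathcal{COP}}(\mathbf b)$ is the supremum of $-\sum_{i=1}^m(2b_i\alpha_i+b_i^2\beta_i)-\theta$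 over $\alpha,\beta\in\mathbb R^m$, $\gamma\in\mathbb R^{\mathcal B}$, $\theta\in\mathbb R$ and symmetric $M$ subject to $C+\sum_{i=1}^m(\alpha_iA_i+\beta_iAA_i)+\sum_{j\in\mathcal B}\gamma_jN_j+\theta T=M$, $M\in\mathcal{COP}$. For $\epsilon\geq 0$, an $\epsilon$-optimal solution of (COP) is a feasible solution with objective value at least $z_{\mathcal{COP}}(\mathbf b)-\epsilon$. *)

theory Defs
  imports "HOL-Analysis.Analysis"
begin

definition outer_prod :: "real ^ 'k \<Rightarrow> real ^ 'l \<Rightarrow> real ^ 'l ^ 'k" where
  "outer_prod u v = (\<chi> p q. u $ p * v $ q)"

text \<open>A matrix of order n+1 is indexed by \<^typ>\<open>'n option\<close>, with \<^const>\<open>None\<close> as the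
  leading index.  \<open>bordered x v S\<close> has corner x, first row and column v, and
  lower right block S.\<close>

definition bordered ::
  "real \<Rightarrow> real ^ 'n \<Rightarrow> real ^ 'n ^ 'n \<Rightarrow> real ^ ('n :: finite) option ^ 'n option" where
  "bordered x v S = (\<chi> p q. case p of
       None \<Rightarrow> (case q of None \<Rightarrow> x | Some l \<Rightarrow> v $ l)
     | Some k \<Rightarrow> (case q of None \<Rightarrow> v $ k | Some l \<Rightarrow> S $ k $ l))"

definition matA :: "('m \<Rightarrow> real ^ 'n) \<Rightarrow> 'm \<Rightarrow> real ^ ('n :: finite) option ^ 'n option" where
  "matA a i = bordered 0 (a i) 0"

definition matAA :: "('m \<Rightarrow> real ^ 'n) \<Rightarrow> 'm \<Rightarrow> real ^ ('n :: finite) option ^ 'n option" where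
  "matAA a i = bordered 0 0 (outer_prod (a i) (a i))"

definition matT :: "real ^ ('n :: finite) option ^ 'n option" where
  "matT = bordered 1 0 0"

definition matN :: "'n \<Rightarrow> real ^ ('n :: finite) option ^ 'n option" where
  "matN j = bordered 0 (- axis j 1) (2 *\<^sub>R outer_prod (axis j 1) (axis j 1))"

definition matC :: "real ^ 'n ^ 'n \<Rightarrow> real ^ 'n \<Rightarrow> real ^ ('n :: finite) option ^ 'n option" where
  "matC Q c = bordered 0 c Q"

definition matKK ::
  "('m \<Rightarrow> real ^ 'n) \<Rightarrow> real ^ 'm \<Rightarrow> 'm \<Rightarrow> real ^ ('n :: finite) option ^ 'n option" where
  "matKK a b i = - (b $ i) *\<^sub>R matA a i + matAA a i + (b $ i)\<^sup>2 *\<^sub>R matT"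

definition copositive :: "(real ^ 'k ^ 'k) set" where
  "copositive = {M. transpose M = M \<and> (\<forall>y. (\<forall>k. 0 \<le> y $ k) \<longrightarrow> 0 \<le> y \<bullet> (M *v y))}"

text \<open>A point of (COP) is a tuple \<open>(\<alpha>, \<beta>, \<gamma>, \<theta>, M)\<close>; the vector \<open>\<gamma>\<close> indexed by the
  set \<open>B\<close> is a function that is \<open>undefined\<close> outside \<open>B\<close>.\<close>

type_synonym ('m, 'n) cop_point =
  "(real ^ 'm) \<times> (real ^ 'm) \<times> ('n \<Rightarrow> real) \<times> real \<times> (real ^ 'n option ^ 'n option)"

definition cop_feasible ::
  "real ^ 'n ^ 'n \<Rightarrow> real ^ 'n \<Rightarrow> ('m :: finite \<Rightarrow> real ^ 'n) \<Rightarrow> ('n :: finite) set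
    \<Rightarrow> ('m, 'n) cop_point set" where
  "cop_feasible Q c a B = {(\<alpha>, \<beta>, \<gamma>, \<theta>, M).
     \<gamma> \<in> B \<rightarrow>\<^sub>E UNIV \<and>
     matC Q c + (\<Sum>i\<in>UNIV. \<alpha> $ i *\<^sub>R matA a i + \<beta> $ i *\<^sub>R matAA a i)
       + (\<Sum>j\<in>B. \<gamma> j *\<^sub>R matN j) + \<theta> *\<^sub>R matT = M \<and>
     M \<in> copositive}"

fun cop_objective :: "real ^ 'm \<Rightarrow> ('m :: finite, 'n :: finite) cop_point \<Rightarrow> real" where
  "cop_objective b (\<alpha>, \<beta>, \<gamma>, \<theta>, M) =
     - (\<Sum>i\<in>UNIV. 2 * b $ i * \<alpha> $ i + (b $ i)\<^sup>2 * \<beta> $ i) - \<theta>"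

text \<open>The supremum is taken in the extended reals: it is \<open>\<infinity>\<close> for an unbounded and
  \<open>-\<infinity>\<close> for an infeasible problem.\<close>

definition cop_value ::
  "real ^ 'n ^ 'n \<Rightarrow> real ^ 'n \<Rightarrow> ('m :: finite \<Rightarrow> real ^ 'n) \<Rightarrow> ('n :: finite) set
    \<Rightarrow> real ^ 'm \<Rightarrow> ereal" where
  "cop_value Q c a B b = (SUP x \<in> cop_feasible Q c a B. ereal (cop_objective b x))"

definition cop_eps_optimal ::
  "real ^ 'n ^ 'n \<Rightarrow> real ^ 'n \<Rightarrow> ('m :: finite \<Rightarrow> real ^ 'n) \<Rightarrow> ('n :: finite) set
    \<Rightarrow> real ^ 'm \<Rightarrow> real \<Rightarrow> ('m, 'n) cop_point \<Rightarrow> bool" where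
  "cop_eps_optimal Q c a B b \<epsilon> x \<longleftrightarrow>
     x \<in> cop_feasible Q c a B \<and>
     ereal (cop_objective b x) \<ge> cop_value Q c a B b - ereal \<epsilon>"

end

theory Submission
  imports Defs
begin

text \<open>The matrix \<open>KK\<^sub>i\<close> is the rank-one matrix \<open>w w\<^sup>T\<close> with \<open>w = (-b\<^sub>i, a\<^sub>i)\<close>, hence
  copositive, so adding it keeps \<open>M\<close> copositive.  The objective changes by
  \<open>-(2 b\<^sub>i (-b\<^sub>i) + b\<^sub>i\<^sup>2) - b\<^sub>i\<^sup>2 = 0\<close>.\<close>

lemma outer_prod_mult_vec: "outer_prod u v *v y = (v \<bullet> y) *\<^sub>R u"
  by (simp add: vec_eq_iff outer_prod_def matrix_vector_mult_def inner_vec_def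
      sum_distrib_left sum_distrib_right mult_ac)

lemma transpose_add: "transpose (A + B) = transpose A + transpose (B :: 'a :: plus ^ 'k ^ 'l)"
  by (simp add: vec_eq_iff transpose_def)

lemma copositive_add:
  assumes "A \<in> copositive" and "B \<in> copositive"
  shows "A + B \<in> copositive"
  using assms by (simp add: copositive_def transpose_add matrix_vector_mult_add_rdistrib inner_add_right)

text \<open>The quadratic form of \<open>outer_prod w w\<close> at \<open>y\<close> is the square of
  the inner product of \<open>w\<close> and \<open>y\<close>.\<close>

lemma copositive_outer_prod_self: "outer_prod w w \<in> copositive"
proof -
  have "transpose (outer_prod w w) = outer_prod w w"
    by (simp add: vec_eq_iff transpose_def outer_prod_def mult.commute)
  moreover have "0 \<le> y \<bullet> (outer_prod w w *v y)" for y
    by (simp add: outer_prod_mult_vec inner_commute)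
  ultimately show ?thesis
    by (simp add: copositive_def)
qed

text \<open>Expanding the square blockwise, the corner comes from \<open>matT\<close>, the border
  from \<open>matA\<close> and the lower right block from \<open>matAA\<close>.\<close>

lemma matKK_eq_outer_prod:
  fixes a :: "'m :: finite \<Rightarrow> real ^ ('n :: finite)" and b :: "real ^ 'm"
  defines "w i \<equiv> (\<chi> p. case p of None \<Rightarrow> - (b $ i) | Some k \<Rightarrow> a i $ k)"
  shows "matKK a b i = outer_prod (w i) (w i)"
  by (simp add: vec_eq_iff w_def matKK_def matA_def matAA_def matT_def bordered_def
      outer_prod_def power2_eq_square split: option.split)

lemma copositive_matKK: "matKK a b i \<in> copositive"
  by (simp add: matKK_eq_outer_prod copositive_outer_prod_self)

text \<open>The shifts of \<alpha>, \<beta> and \<theta> are the coefficients of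
  \<open>matA a i\<close>, \<open>matAA a i\<close> and \<open>matT\<close> in
  \<open>matKK a b i\<close>, so both sides of the equality constraint grow by that matrix.\<close>

lemma cop_feasible_shift:
  assumes "(\<alpha>, \<beta>, \<gamma>, \<theta>, M) \<in> cop_feasible Q c a B"
  shows "(\<alpha> - axis i (b $ i), \<beta> + axis i 1, \<gamma>, \<theta> + (b $ i)\<^sup>2, M + matKK a b i) \<in> cop_feasible Q c a B"
proof -
  have "(\<alpha> - axis i (b $ i)) $ h *\<^sub>R matA a h + (\<beta> + axis i 1) $ h *\<^sub>R matAA a h =
      (\<alpha> $ h *\<^sub>R matA a h + \<beta> $ h *\<^sub>R matAA a h) +
      (if h = i then - (b $ i) *\<^sub>R matA a i + matAA a i else 0)" for h
    by (simp add: axis_def algebra_simps)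
  then have "(\<Sum>h\<in>UNIV. (\<alpha> - axis i (b $ i)) $ h *\<^sub>R matA a h + (\<beta> + axis i 1) $ h *\<^sub>R matAA a h) =
      (\<Sum>h\<in>UNIV. \<alpha> $ h *\<^sub>R matA a h + \<beta> $ h *\<^sub>R matAA a h) +
      (- (b $ i) *\<^sub>R matA a i + matAA a i)"
    \<comment> \<open>Fixing the second summand as the conditional splits off only the correction
      and keeps the \<alpha> and \<beta> terms under one sum.\<close>
    by (simp only: sum.distrib[of _ "\<lambda>h. if h = i then _ else _"] sum.delta' sum.delta finite UNIV_I if_True)
  moreover have "M + matKK a b i \<in> copositive"
    using assms by (auto simp: cop_feasible_def intro!: copositive_add copositive_matKK)
  ultimately show ?thesis
    using assms by (auto simp: cop_feasible_def matKK_def scaleR_add_left)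
qed

text \<open>The objective does not read the matrix component, so \<open>M'\<close> and
  \<open>M\<close> may be unrelated.\<close>

lemma cop_objective_shift:
  "cop_objective b (\<alpha> - axis i (b $ i), \<beta> + axis i 1, \<gamma>, \<theta> + (b $ i)\<^sup>2, M') =
    cop_objective b (\<alpha>, \<beta>, \<gamma>, \<theta>, M)"
proof -
  \<comment> \<open>At \<open>h = i\<close> the change is
    \<open>-2 (b $ i)\<^sup>2 + (b $ i)\<^sup>2\<close>; the shift of \<theta> cancels it.\<close>
  have "2 * b $ h * (\<alpha> - axis i (b $ i)) $ h + (b $ h)\<^sup>2 * (\<beta> + axis i 1) $ h =
      (2 * b $ h * \<alpha> $ h + (b $ h)\<^sup>2 * \<beta> $ h) + (if h = i then - (b $ i)\<^sup>2 else 0)" for h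
    by (simp add: axis_def algebra_simps power2_eq_square)
  then show ?thesis
    by (simp add: sum.distrib[of _ "\<lambda>h. if h = i then _ else _"])
qed

theorem proposition5:
  fixes Q :: "real ^ 'n ^ 'n" and c :: "real ^ 'n" and a :: "'m :: finite \<Rightarrow> real ^ 'n"
    and B :: "('n :: finite) set" and b :: "real ^ 'm" and \<epsilon> :: real and i :: 'm
    and \<alpha> \<beta> :: "real ^ 'm" and \<gamma> :: "'n \<Rightarrow> real" and \<theta> :: real
    and M :: "real ^ 'n option ^ 'n option"
  assumes "transpose Q = Q" and "\<And>k l. Q $ k $ l \<in> \<rat>"
    and "\<And>k. c $ k \<in> \<rat>" and "\<And>h k. a h $ k \<in> \<rat>" and "\<And>h. b $ h \<in> \<rat>"
    and "\<epsilon> \<ge> 0"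
    and "cop_eps_optimal Q c a B b \<epsilon> (\<alpha>, \<beta>, \<gamma>, \<theta>, M)"
  shows "cop_eps_optimal Q c a B b \<epsilon>
    (\<alpha> - axis i (b $ i), \<beta> + axis i 1, \<gamma>, \<theta> + (b $ i)\<^sup>2, M + matKK a b i)"
  \<comment> \<open>The optimal value is the same for both points, so equal objectives give the same
    gap.\<close>
  using assms(7) unfolding cop_eps_optimal_def
  by (metis cop_feasible_shift cop_objective_shift)

end
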